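(* For $n\geq 1$ let $\mu(n)$ denote the degree of the variant $\mathcal T_n^a$ where $a\in\mathcal T_n$ has rank $1$. For any integer $k\geq 2$ we have $\mu(n)\geq n+k$ for all integers $n\geq\lceil k\ln k\rceil+1$.
   Context: $\mathcal T_n$ is the full transformation semigroup on $\{1,\dots,n\}$; the rank of a transformation is the size of its image. The variant $\mathcal T_n^a$ is the set $\mathcal T_n$ with operation $f\star g=fag$. The degree of a finite semigroup $S$ is the least $m\geq1$ such that $S$ embeds in $\mathcal T_m$. The degree of $\mathcal T_n^a$ does not depend on the choice of the rank-$1$ map $a$. *)

theory Defs
  imports Complex_Main "HOL-Library.FuncSet"
begin

definition full_transf :: "nat \<Rightarrow> (nat \<Rightarrow> nat) set" where
  "full_transf n = {1..n} \<rightarrow>\<^sub>E {1..n}"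

(* Transformations act on the right: the product fg applies f first. *)
definition transf_mult :: "nat \<Rightarrow> (nat \<Rightarrow> nat) \<Rightarrow> (nat \<Rightarrow> nat) \<Rightarrow> nat \<Rightarrow> nat" where
  "transf_mult n f g = compose {1..n} g f"

definition transf_rank :: "nat \<Rightarrow> (nat \<Rightarrow> nat) \<Rightarrow> nat" where
  "transf_rank n f = card (f ` {1..n})"

definition variant_mult ::
    "nat \<Rightarrow> (nat \<Rightarrow> nat) \<Rightarrow> (nat \<Rightarrow> nat) \<Rightarrow> (nat \<Rightarrow> nat) \<Rightarrow> nat \<Rightarrow> nat" where
  "variant_mult n a f g = transf_mult n (transf_mult n f a) g"

(* A semigroup is given by its carrier S and its operation; HOL-Algebra structures
   with a multiplication also carry a unit, which a variant need not have. *)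
definition semigroup_embedding ::
    "'a set \<Rightarrow> ('a \<Rightarrow> 'a \<Rightarrow> 'a) \<Rightarrow> 'b set \<Rightarrow> ('b \<Rightarrow> 'b \<Rightarrow> 'b) \<Rightarrow> ('a \<Rightarrow> 'b) \<Rightarrow> bool" where
  "semigroup_embedding S mS T mT h \<longleftrightarrow>
     h \<in> S \<rightarrow> T \<and> inj_on h S \<and> (\<forall>x\<in>S. \<forall>y\<in>S. h (mS x y) = mT (h x) (h y))"

(* The least element exists whenever S is a finite semigroup, by Cayley's theorem. *)
definition semigroup_degree :: "'a set \<Rightarrow> ('a \<Rightarrow> 'a \<Rightarrow> 'a) \<Rightarrow> nat" where
  "semigroup_degree S mS =
     (LEAST m. 1 \<le> m \<and> (\<exists>h. semigroup_embedding S mS (full_transf m) (transf_mult m) h))"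

end

theory Submission
  imports Defs
begin

text \<open>
  If \<open>a\<close> is constant with value \<open>c\<close>, then \<open>f \<star> g\<close> is the constant map with value \<open>g c\<close>.
  Let \<open>h\<close> embed the variant in the transformations of \<open>{1..m}\<close>, and let \<open>Y\<close> be the union of the
  images of all \<open>h f\<close>. The value of \<open>h g\<close> at a point \<open>h f x\<close> of \<open>Y\<close> is that of \<open>h (f \<star> g)\<close>
  at \<open>x\<close>, so it depends only on \<open>g c\<close>. Hence the \<open>n ^ (n - 1)\<close> maps \<open>g\<close> with a prescribed value
  at \<open>c\<close> are separated by the restrictions of \<open>h g\<close> to the complement of \<open>Y\<close>, which take values
  in \<open>Y\<close>. So \<open>n ^ (n - 1) \<le> p ^ q\<close> with \<open>p + q = m\<close>, and for \<open>n - 1 \<ge> k ln k\<close> this is impossible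
  when \<open>m < n + k\<close>.
\<close>

lemma variant_mult_const:
  assumes f: "f \<in> full_transf n" and a: "a ` {1..n} = {c}"
  shows "variant_mult n a f g = (\<lambda>x\<in>{1..n}. g c)"
proof
  fix x
  have "a (f x) = c" if "x \<in> {1..n}"
    using that f a unfolding full_transf_def by blast
  then show "variant_mult n a f g x = (\<lambda>x\<in>{1..n}. g c) x"
    by (auto simp: variant_mult_def transf_mult_def compose_def)
qed

text \<open>Any embedding will do here: it shows that the \<open>LEAST\<close> in
  \<open>semigroup_degree\<close> is attained.\<close>

lemma variant_rank1_embedding_exists:
  assumes c: "c \<in> {1..n}" and a: "a ` {1..n} = {c}"
  shows "\<exists>h. semigroup_embedding (full_transf n) (variant_mult n a)
               (full_transf (2 * n)) (transf_mult (2 * n)) h"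
proof -
  \<comment> \<open>The upper block stores a copy of \<open>g\<close>, which gives injectivity. All
    images lie in the lower block, so a second factor contributes only its constant value
    \<open>g c\<close> there.\<close>
  define h where "h = (\<lambda>g. \<lambda>y\<in>{1..2 * n}. if y \<le> n then g c else (g (y - n) :: nat))"
  have range: "g x \<in> {1..n}" if "g \<in> full_transf n" "x \<in> {1..n}" for g x
    using that unfolding full_transf_def by blast
  have h_range: "h g y \<in> {1..n}" if "g \<in> full_transf n" "y \<in> {1..2 * n}" for g y
  proof (cases "y \<le> n")
    case True
    then show ?thesis using that range[OF that(1) c] by (simp add: h_def)
  next
    case False
    then have "y - n \<in> {1..n}" using that by auto
    then show ?thesis using False that range[OF that(1)] by (simp add: h_def)
  qed
  have "h \<in> full_transf n \<rightarrow> full_transf (2 * n)"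
  proof
    fix g assume "g \<in> full_transf n"
    have "h g y \<in> {1..2 * n}" if "y \<in> {1..2 * n}" for y
      using h_range[OF \<open>g \<in> full_transf n\<close> that] by simp
    moreover have "h g \<in> extensional {1..2 * n}" by (simp add: h_def)
    ultimately show "h g \<in> full_transf (2 * n)"
      unfolding full_transf_def PiE_iff by blast
  qed
  moreover have "inj_on h (full_transf n)"
  proof (rule inj_onI)
    fix f g assume fg: "f \<in> full_transf n" "g \<in> full_transf n" and eq: "h f = h g"
    have "f x = g x" if "x \<in> {1..n}" for x
      using fun_cong[OF eq, of "x + n"] that by (simp add: h_def)
    then show "f = g"
      using fg unfolding full_transf_def by (intro PiE_ext)
  qed
  moreover have "h (variant_mult n a f g) = transf_mult (2 * n) (h f) (h g)"
    if "f \<in> full_transf n" for f g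
  proof
    fix y
    have "h g (h f y) = g c" if "y \<in> {1..2 * n}"
      using h_range[OF \<open>f \<in> full_transf n\<close> that] by (simp add: h_def)
    moreover have "h (\<lambda>x\<in>{1..n}. g c) y = g c" if "y \<in> {1..2 * n}"
      using that c by (auto simp: h_def)
    ultimately show "h (variant_mult n a f g) y = transf_mult (2 * n) (h f) (h g) y"
      using that by (cases "y \<in> {1..2 * n}")
        (auto simp: variant_mult_const[OF _ a] transf_mult_def compose_def h_def)
  qed
  ultimately show ?thesis
    unfolding semigroup_embedding_def by blast
qed

text \<open>The numbers \<open>p\<close> and \<open>q\<close> are the sizes of \<open>Y\<close> and
  of its complement in \<open>{1..m}\<close>.\<close>

lemma variant_rank1_embedding_bound:
  assumes c: "c \<in> {1..n}" and a: "a ` {1..n} = {c}"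
    and h: "semigroup_embedding (full_transf n) (variant_mult n a)
              (full_transf m) (transf_mult m) h"
  obtains p q where "p + q = m" "n ^ (n - 1) \<le> p ^ q"
proof -
  let ?X = "{1..m}" and ?S = "full_transf n"
  define Y where "Y = (\<Union>f\<in>?S. h f ` ?X)"
  \<comment> \<open>The prescribed value at \<open>c\<close> is taken to be \<open>c\<close> itself.
    The product form lets \<open>card_PiE\<close> count these maps.\<close>
  define F where "F = (\<Pi>\<^sub>E x\<in>{1..n}. if x = c then {c} else {1..n})"
  define r where "r = (\<lambda>g. restrict (h g) (?X - Y))"
  have hS: "h f \<in> ?X \<rightarrow>\<^sub>E ?X" if "f \<in> ?S" for f
    using h that unfolding semigroup_embedding_def full_transf_def by blast
  have Y: "Y \<subseteq> ?X"
    using hS unfolding Y_def by blast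
  have F: "g \<in> ?S \<and> g c = c" if "g \<in> F" for g
  proof
    have "F \<subseteq> ?S"
      unfolding F_def full_transf_def using c by (intro PiE_mono) simp
    then show "g \<in> ?S" using that by blast
    show "g c = c" using PiE_mem[OF that[unfolded F_def] c] by simp
  qed
  have on_Y: "h g y = h g' y" if "g \<in> F" "g' \<in> F" "y \<in> Y" for g g' y
  proof -
    obtain f x where fx: "f \<in> ?S" "x \<in> ?X" "y = h f x"
      using \<open>y \<in> Y\<close> unfolding Y_def by blast
    have "h u y = h (\<lambda>x\<in>{1..n}. c) x" if "u \<in> F" for u
    proof -
      have "h (variant_mult n a f u) = transf_mult m (h f) (h u)"
        using h fx F[OF that] unfolding semigroup_embedding_def by blast
      then show ?thesis
        using fx F[OF that] by (simp add: variant_mult_const[OF _ a] transf_mult_def compose_def)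
    qed
    then show ?thesis using that by simp
  qed
  have "inj_on r F"
  proof (rule inj_onI)
    fix g g' assume g: "g \<in> F" "g' \<in> F" and eq: "r g = r g'"
    have "h g x = h g' x" for x
    proof (cases "x \<in> ?X")
      case True
      then show ?thesis
        using on_Y[OF g] fun_cong[OF eq, of x] by (cases "x \<in> Y") (auto simp: r_def)
    next
      case False
      then show ?thesis
        using PiE_arb[OF hS, of g x] PiE_arb[OF hS, of g' x] F[OF g(1)] F[OF g(2)] by simp
    qed
    then have "h g = h g'" by blast
    then show "g = g'"
      using h F g unfolding semigroup_embedding_def by (meson inj_onD)
  qed
  moreover have "r ` F \<subseteq> (?X - Y) \<rightarrow>\<^sub>E Y"
  proof
    fix u assume "u \<in> r ` F"
    then obtain g where g: "g \<in> F" "u = r g" by blast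
    have "h g x \<in> Y" if "x \<in> ?X" for x
      using that F[OF g(1)] unfolding Y_def by blast
    then show "u \<in> (?X - Y) \<rightarrow>\<^sub>E Y" unfolding g(2) r_def by simp
  qed
  moreover have finY: "finite Y"
    using Y finite_subset by blast
  ultimately have "card F \<le> card ((?X - Y) \<rightarrow>\<^sub>E Y)"
    by (intro card_inj_on_le[of r] finite_PiE) auto
  also have "card ((?X - Y) \<rightarrow>\<^sub>E Y) = card Y ^ card (?X - Y)"
    by (simp add: card_funcsetE)
  also have "card F = n ^ (n - 1)"
  proof -
    have "card F = (\<Prod>x\<in>{1..n}. if x = c then 1 else n)"
      unfolding F_def by (subst card_PiE) (auto intro!: prod.cong)
    also have "\<dots> = n ^ (n - 1)"
      using c by (subst prod.remove[of _ c]) (simp_all add: prod.If_cases[of "{1..n} - {c}"])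
    finally show ?thesis .
  qed
  finally have "n ^ (n - 1) \<le> card Y ^ card (?X - Y)" .
  moreover have "card Y + card (?X - Y) = m"
    using Y finY card_mono[OF _ Y] by (simp add: card_Diff_subset)
  ultimately show thesis using that by blast
qed

text \<open>This is \<open>p ^ q < n ^ (n - 1)\<close> in logarithms. For \<open>p < k\<close> the
  exponent may exceed \<open>n - 1\<close>, but \<open>ln p\<close> is small enough to compensate;
  for \<open>k \<le> p < n\<close> both factors are under control; for \<open>n \<le> p\<close> the
  exponent is at most \<open>k - 1 - (p - n)\<close>.\<close>

lemma mult_ln_less_of_sum_less:
  fixes k n p q :: nat
  assumes k: "k \<ge> 2" and kn: "k < n" and n: "real k * ln (real k) \<le> real n - 1"
    and p: "p > 0" and pq: "p + q < n + k"
  shows "real q * ln (real p) < (real n - 1) * ln (real n)"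
proof -
  have lnn: "ln (real n) \<ge> 1"
  proof -
    have "exp 1 \<le> real n" using exp_le kn k by linarith
    then show ?thesis using kn by (simp add: ln_ge_iff)
  qed
  consider "p < k" | "k \<le> p" "p < n" | "n \<le> p" by linarith
  then show ?thesis
  proof cases
    case 1
    have "ln (real p / real k) \<le> real p / real k - 1"
      using p k by (intro ln_le_minus_one) simp
    then have "(real k - real p) / real k \<le> ln (real k) - ln (real p)"
      using p k by (simp add: ln_div field_simps)
    also have "\<dots> < ln (real n) - ln (real p)" using kn k by simp
    finally have gap: "(real k - real p) / real k < ln (real n) - ln (real p)" .
    have "real q * ln (real p) \<le> (real n - 1 + (real k - real p)) * ln (real p)"
      using pq p by (intro mult_right_mono) auto
    also have "(real k - real p) * ln (real p) \<le> (real k - real p) * ln (real k)"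
      using 1 p by (intro mult_left_mono) auto
    \<comment> \<open>Splitting off the factor \<open>k ln k\<close> makes the hypothesis on
      \<open>n\<close> applicable. The resulting \<open>(n - 1) (k - p) / k\<close> is then absorbed
      by the gap between \<open>ln n\<close> and \<open>ln p\<close>.\<close>
    then have "(real n - 1 + (real k - real p)) * ln (real p)
        \<le> (real n - 1) * ln (real p) + real k * ln (real k) * ((real k - real p) / real k)"
      using k by (simp add: mult.commute ring_distribs(1))
    also have "real k * ln (real k) * ((real k - real p) / real k)
        \<le> (real n - 1) * ((real k - real p) / real k)"
      using 1 n by (intro mult_right_mono) auto
    also have "(real n - 1) * ((real k - real p) / real k)
        < (real n - 1) * (ln (real n) - ln (real p))"
      using gap kn k by (intro mult_strict_left_mono) auto
    finally show ?thesis by (simp add: algebra_simps)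
  next
    case 2
    have "real q * ln (real p) \<le> (real n - 1) * ln (real p)"
      using 2 pq p by (intro mult_right_mono) auto
    also have "\<dots> < (real n - 1) * ln (real n)"
      using 2 p kn k by (intro mult_strict_left_mono) auto
    finally show ?thesis .
  next
    case 3
    define d where "d = real p - real n"
    have d: "d \<ge> 0" "real q \<le> real k - 1 - d" using 3 pq by (auto simp: d_def)
    have "ln (real p / real n) \<le> real p / real n - 1"
      using p kn by (intro ln_le_minus_one) simp
    then have lnp: "ln (real p) \<le> ln (real n) + d / real n"
      using p kn by (simp add: ln_div d_def field_simps)
    have "real q * ln (real p) \<le> real q * ln (real n) + d * (real q / real n)"
      using mult_left_mono[OF lnp, of "real q"] by (simp add: algebra_simps)
    \<comment> \<open>Since \<open>q < n\<close> and \<open>ln n \<ge> 1\<close>, raising the base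
      by \<open>d\<close> costs no more than \<open>d\<close> further factors \<open>n\<close>, and
      \<open>q + d \<le> k - 1 < n - 1\<close>.\<close>
    also have "d * (real q / real n) \<le> d * ln (real n)"
    proof (rule mult_left_mono)
      have "real q / real n \<le> 1" using d kn by simp
      then show "real q / real n \<le> ln (real n)" using lnn by simp
    qed (use d in simp)
    also have "real q * ln (real n) + d * ln (real n) = (real q + d) * ln (real n)"
      by (simp add: algebra_simps)
    also have "\<dots> < (real n - 1) * ln (real n)"
      using d kn lnn by (intro mult_strict_right_mono) auto
    finally show ?thesis by simp
  qed
qed

text \<open>For \<open>k \<ge> 3\<close> this follows from \<open>ln k \<ge> 1\<close>. As
  \<open>ln 2 < 1\<close>, the case \<open>k = 2\<close> instead uses
  \<open>2 ln 2 = ln 4 > 1\<close>.\<close>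

lemma less_of_mult_ln_le:
  fixes k n :: nat
  assumes k: "k \<ge> 2" and n: "real k * ln (real k) \<le> real n - 1"
  shows "k < n"
proof (cases "k = 2")
  case True
  have "exp 1 < (2 ^ 2 :: real)" using order_le_less_trans[OF exp_le] by simp
  then have "ln (exp 1) < ln (2 ^ 2 :: real)" by (subst ln_less_cancel_iff) auto
  then have "1 < 2 * ln (2 :: real)" by (simp only: ln_realpow ln_exp of_nat_numeral)
  then show ?thesis using n True by simp
next
  case False
  then have "exp 1 \<le> real k" using exp_le k by linarith
  then have "1 \<le> ln (real k)" using k by (simp add: ln_ge_iff)
  then have "real k * 1 \<le> real k * ln (real k)" by (intro mult_left_mono) auto
  then show ?thesis using n by linarith
qed

theorem theorem5p28:
  fixes k n :: nat and a :: "nat \<Rightarrow> nat"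
  assumes "k \<ge> 2"
    and "int n \<ge> \<lceil>real k * ln (real k)\<rceil> + 1"
    and "a \<in> full_transf n"
    and "transf_rank n a = 1"
  shows "semigroup_degree (full_transf n) (variant_mult n a) \<ge> n + k"
proof -
  have kln: "real k * ln (real k) \<le> real n - 1"
    using assms(2) by linarith
  have kn: "k < n" using less_of_mult_ln_le[OF assms(1) kln] .
  obtain c where a: "a ` {1..n} = {c}"
    using assms(4) unfolding transf_rank_def by (auto simp: card_1_singleton_iff)
  have c: "c \<in> {1..n}"
  proof -
    have "a ` {1..n} \<subseteq> {1..n}"
      using assms(3) unfolding full_transf_def by blast
    then show ?thesis using a by simp
  qed
  let ?P = "\<lambda>m. 1 \<le> m \<and> (\<exists>h. semigroup_embedding (full_transf n) (variant_mult n a)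
                                   (full_transf m) (transf_mult m) h)"
  have "?P (2 * n)"
    using variant_rank1_embedding_exists[OF c a] kn by simp
  then have "?P (semigroup_degree (full_transf n) (variant_mult n a))"
    unfolding semigroup_degree_def by (rule LeastI)
  then obtain p q where pq: "p + q = semigroup_degree (full_transf n) (variant_mult n a)"
    and le: "n ^ (n - 1) \<le> p ^ q"
    using variant_rank1_embedding_bound[OF c a] by metis
  have n2: "1 < n" using kn assms(1) by simp
  have p: "p > 0"
  proof (rule ccontr)
    assume "\<not> p > 0"
    \<comment> \<open>The bound is 1 rather than 0 because \<open>0 ^ 0 = 1\<close>.\<close>
    then have "p ^ q \<le> 1" by (simp add: power_0_left)
    moreover have "1 < n ^ (n - 1)" using n2 by (intro one_less_power) auto
    ultimately show False using le by linarith
  qed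
  have "real n ^ (n - 1) \<le> real p ^ q"
    using le by (metis of_nat_le_iff of_nat_power)
  then have "ln (real n ^ (n - 1)) \<le> ln (real p ^ q)"
    using n2 p by simp
  then have "(real n - 1) * ln (real n) \<le> real q * ln (real p)"
    using n2 p by (simp add: ln_realpow of_nat_diff)
  then have "\<not> p + q < n + k"
    using mult_ln_less_of_sum_less[OF assms(1) kn kln p] by (meson not_le)
  then show ?thesis using pq by simp
qed

end
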